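(* Let $R$ be a ring. (i) If $R$ is semi-nil clean and the set ${\rm Nil}(R)$ of nilpotent elements is an additive subgroup of $R$, then the Jacobson radical ${\rm J}(R)$ is nil (every element of it is nilpotent). (ii) In particular, $R$ is a semi-nil clean NI ring if and only if ${\rm J}(R)={\rm Nil}(R)$ and $R$ is a periodic ring.
   Context: Rings are associative with identity, not necessarily commutative. An element $x$ of a ring $R$ is periodic if there exist two different positive integers $m\neq n$ with $x^m=x^n$; a ring is periodic if all its elements are periodic. An element is semi-nil clean if it is the sum of a periodic element and a nilpotent element of $R$ (no commutation required); a ring is semi-nil clean if all its elements are semi-nil clean. ${\rm Nil}(R)$ denotes the set of all nilpotent elements of $R$, and ${\rm J}(R)$ the Jacobson radical. $R$ is an NI ring if ${\rm Nil}(R)$ is a (two-sided) ideal of $R$. *)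

theory Defs
  imports "HOL-Algebra.Ideal"
begin

definition periodic_element :: "('a, 'b) ring_scheme \<Rightarrow> 'a \<Rightarrow> bool" where
  "periodic_element R x \<longleftrightarrow>
     x \<in> carrier R \<and>
     (\<exists>m n :: nat. 0 < m \<and> 0 < n \<and> m \<noteq> n \<and> x [^]\<^bsub>R\<^esub> m = x [^]\<^bsub>R\<^esub> n)"

definition periodic_ring :: "('a, 'b) ring_scheme \<Rightarrow> bool" where
  "periodic_ring R \<longleftrightarrow> (\<forall>x \<in> carrier R. periodic_element R x)"

definition nilpotent_element :: "('a, 'b) ring_scheme \<Rightarrow> 'a \<Rightarrow> bool" where
  "nilpotent_element R x \<longleftrightarrow>
     x \<in> carrier R \<and> (\<exists>n :: nat. 0 < n \<and> x [^]\<^bsub>R\<^esub> n = \<zero>\<^bsub>R\<^esub>)"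

definition Nil_set :: "('a, 'b) ring_scheme \<Rightarrow> 'a set" where
  "Nil_set R = {x. nilpotent_element R x}"

definition semi_nil_clean_element :: "('a, 'b) ring_scheme \<Rightarrow> 'a \<Rightarrow> bool" where
  "semi_nil_clean_element R x \<longleftrightarrow>
     (\<exists>p q. periodic_element R p \<and> nilpotent_element R q \<and> x = p \<oplus>\<^bsub>R\<^esub> q)"

definition semi_nil_clean_ring :: "('a, 'b) ring_scheme \<Rightarrow> bool" where
  "semi_nil_clean_ring R \<longleftrightarrow> (\<forall>x \<in> carrier R. semi_nil_clean_element R x)"

definition NI_ring :: "('a, 'b) ring_scheme \<Rightarrow> bool" where
  "NI_ring R \<longleftrightarrow> ideal (Nil_set R) R"

text \<open>One-sided counterparts of the library locales \<^locale>\<open>ideal\<close> and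
  \<^locale>\<open>maximalideal\<close>, which are two-sided.\<close>

locale left_ideal = additive_subgroup I R + ring R for I and R (structure) +
  assumes I_l_closed: "\<lbrakk>a \<in> I; x \<in> carrier R\<rbrakk> \<Longrightarrow> x \<otimes> a \<in> I"

locale maximal_left_ideal = left_ideal +
  assumes I_notcarr: "carrier R \<noteq> I"
    and I_maximal:
      "\<lbrakk>left_ideal J R; I \<subseteq> J; J \<subseteq> carrier R\<rbrakk> \<Longrightarrow> J = I \<or> J = carrier R"

text \<open>The Jacobson radical is the intersection of all maximal left ideals.
  The zero ring has none; the intersection is taken inside the carrier, so that
  the radical is then the whole ring.\<close>

definition jacobson_radical :: "('a, 'b) ring_scheme \<Rightarrow> 'a set" where
  "jacobson_radical R = carrier R \<inter> \<Inter>{M. maximal_left_ideal M R}"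

end

theory Submission
  imports Defs
begin

text \<open>Write \<open>x = p + q\<close> with \<open>p\<close> periodic and \<open>q\<close> nilpotent.
  If \<open>x\<close> lies in the radical \<open>J\<close>, then \<open>p\<close> is congruent to \<open>-q\<close> modulo \<open>J\<close>, so a power of
  \<open>p\<close> lies in \<open>J\<close>. Some power of \<open>p\<close> is idempotent, hence \<open>J\<close> contains an idempotent power of
  \<open>p\<close>, which must vanish. So \<open>p\<close> is nilpotent, and so is \<open>x\<close>.

  In the NI case, \<open>x\<close> is congruent to \<open>p\<close> modulo the nilpotents, so \<open>x ^ m - x ^ n\<close> is
  nilpotent for some \<open>m < n\<close>. Applied to \<open>x = 2\<close>, this gives positive characteristic \<open>N\<close>.
  For \<open>y = x ^ (n - m)\<close> and \<open>s = x ^ (m k)\<close> we get \<open>s (y - 1) ^ k = 0\<close>: the \<open>k\<close>-th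
  differences of the sequence \<open>s y ^ j\<close> vanish, and in characteristic \<open>N\<close> such a
  sequence is periodic.\<close>

lemma mem_Nil_set_iff:
  "x \<in> Nil_set R \<longleftrightarrow>
     x \<in> carrier R \<and> (\<exists>n :: nat. 0 < n \<and> x [^]\<^bsub>R\<^esub> n = \<zero>\<^bsub>R\<^esub>)"
  by (simp add: Nil_set_def nilpotent_element_def)

context ring
begin

subsection \<open>Left ideals and the Jacobson radical\<close>

text \<open>Closure under negation comes from left multiplication by
  \<open>\<ominus> \<one>\<close>.\<close>

lemma left_idealI:
  assumes "I \<subseteq> carrier R" "\<zero> \<in> I"
    and "\<And>a b. \<lbrakk>a \<in> I; b \<in> I\<rbrakk> \<Longrightarrow> a \<oplus> b \<in> I"
    and l: "\<And>a x. \<lbrakk>a \<in> I; x \<in> carrier R\<rbrakk> \<Longrightarrow> x \<otimes> a \<in> I"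
  shows "left_ideal I R"
proof -
  have "\<ominus> a \<in> I" if "a \<in> I" for a
  proof -
    have "a \<in> carrier R" using that assms(1) by blast
    then have "\<ominus> a = (\<ominus> \<one>) \<otimes> a" by (simp add: l_minus)
    then show ?thesis using l[OF that, of "\<ominus> \<one>"] by simp
  qed
  then have "subgroup I (add_monoid R)"
    using assms by (intro add.subgroupI) (auto simp: a_inv_def)
  then show ?thesis
    by (intro left_ideal.intro additive_subgroupI left_ideal_axioms.intro ring_axioms l)
qed

lemma left_ideal_eq_carrier_iff:
  assumes "left_ideal I R"
  shows "I = carrier R \<longleftrightarrow> \<one> \<in> I"
proof -
  interpret I: left_ideal I R by fact
  show ?thesis using I.I_l_closed[of \<one>] I.a_subset by fastforce
qed

text \<open>This is \<open>M + K r\<close>. It serves with \<open>K\<close> the whole ring, with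
  \<open>M\<close> zero (a principal left ideal), and with \<open>K\<close> above a residual of
  \<open>M\<close>.\<close>

lemma left_ideal_sum_principal:
  assumes "left_ideal M R" and r: "r \<in> carrier R" and K: "left_ideal K R"
  shows "left_ideal {m \<oplus> a \<otimes> r | m a. m \<in> M \<and> a \<in> K} R" (is "left_ideal ?S R")
proof -
  interpret M: left_ideal M R by fact
  interpret K: left_ideal K R by fact
  have Kc: "a \<in> carrier R" if "a \<in> K" for a using that K.a_subset by blast
  have Mc: "a \<in> carrier R" if "a \<in> M" for a using that M.a_subset by blast
  show ?thesis
  proof (rule left_idealI)
    show "?S \<subseteq> carrier R" using r Kc Mc by auto
    have "\<zero> = \<zero> \<oplus> \<zero> \<otimes> r" using r by simp
    then show "\<zero> \<in> ?S" using M.zero_closed K.zero_closed by blast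
  next
    fix x y assume "x \<in> ?S" "y \<in> ?S"
    then obtain m a m' a' where
      x: "x = m \<oplus> a \<otimes> r" "m \<in> M" "a \<in> K" and y: "y = m' \<oplus> a' \<otimes> r" "m' \<in> M" "a' \<in> K"
      by blast
    have "x \<oplus> y = (m \<oplus> m') \<oplus> (a \<oplus> a') \<otimes> r"
      using x y r by (simp add: Kc Mc l_distr a_ac)
    then show "x \<oplus> y \<in> ?S" using M.a_closed[OF x(2) y(2)] K.a_closed[OF x(3) y(3)] by blast
  next
    fix x b assume "x \<in> ?S" and b: "b \<in> carrier R"
    then obtain m a where x: "x = m \<oplus> a \<otimes> r" "m \<in> M" "a \<in> K" by blast
    have "b \<otimes> x = b \<otimes> m \<oplus> (b \<otimes> a) \<otimes> r"
      using x r b by (simp add: Kc Mc r_distr m_assoc)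
    then show "b \<otimes> x \<in> ?S" using M.I_l_closed[OF x(2) b] K.I_l_closed[OF x(3) b] by blast
  qed
qed

lemma left_ideal_carrier: "left_ideal (carrier R) R"
  by (rule left_idealI) auto

lemma left_ideal_zero: "left_ideal {\<zero>} R"
  by (rule left_idealI) auto

lemma left_ideal_Union_chain:
  assumes ne: "C \<noteq> {}" and chain: "subset.chain {J. left_ideal J R} C"
  shows "left_ideal (\<Union>C) R"
proof (rule left_idealI)
  have li: "left_ideal J R" if "J \<in> C" for J
    using chain that by (auto simp: subset.chain_def)
  note zero = additive_subgroup.zero_closed[OF left_ideal.axioms(1)[OF li]]
    and sub = additive_subgroup.a_subset[OF left_ideal.axioms(1)[OF li]]
    and add = additive_subgroup.a_closed[OF left_ideal.axioms(1)[OF li]]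
  show "\<Union>C \<subseteq> carrier R" using sub by blast
  show "\<zero> \<in> \<Union>C" using ne zero by blast
  show "a \<oplus> b \<in> \<Union>C" if "a \<in> \<Union>C" "b \<in> \<Union>C" for a b
  proof -
    from that obtain A B where AB: "A \<in> C" "a \<in> A" "B \<in> C" "b \<in> B" by blast
    then have "A \<subseteq> B \<or> B \<subseteq> A" using chain by (auto simp: subset_chain_def)
    then show ?thesis using AB add by blast
  qed
  show "x \<otimes> a \<in> \<Union>C" if "a \<in> \<Union>C" "x \<in> carrier R" for a x
    using that left_ideal.I_l_closed[OF li] by blast
qed

text \<open>Zorn's lemma on the left ideals above \<open>I\<close> that omit \<open>\<one>\<close>,
  a condition inherited by unions of chains. Omitting \<open>\<one>\<close> is the same as being
  proper, so a maximal member is a maximal left ideal.\<close>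

lemma ex_maximal_left_ideal:
  assumes I: "left_ideal I R" and one: "\<one> \<notin> I"
  obtains M where "maximal_left_ideal M R" "I \<subseteq> M"
proof -
  let ?A = "{J. left_ideal J R \<and> I \<subseteq> J \<and> \<one> \<notin> J}"
  have "\<exists>M\<in>?A. \<forall>X\<in>?A. M \<subseteq> X \<longrightarrow> X = M"
  proof (rule subset_Zorn_nonempty)
    show "?A \<noteq> {}" using I one by blast
    fix C assume C: "C \<noteq> {}" "subset.chain ?A C"
    then have "left_ideal (\<Union>C) R"
      by (intro left_ideal_Union_chain) (auto simp: subset_chain_def)
    then show "\<Union>C \<in> ?A" using C by (auto simp: subset_chain_def)
  qed
  then obtain M where "M \<in> ?A" and max: "\<forall>X\<in>?A. M \<subseteq> X \<longrightarrow> X = M" ..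
  then have M: "left_ideal M R" "I \<subseteq> M" "\<one> \<notin> M" by auto
  have "maximal_left_ideal M R"
  proof (intro maximal_left_ideal.intro maximal_left_ideal_axioms.intro M(1))
    show "carrier R \<noteq> M" using M(3) one_closed by blast
    show "J = M \<or> J = carrier R" if "left_ideal J R" "M \<subseteq> J" for J
      using bspec[OF max, of J] left_ideal_eq_carrier_iff[of J] that M(2) by blast
  qed
  then show thesis using M that by blast
qed

lemma maximal_left_ideal_one_notin:
  assumes "maximal_left_ideal M R"
  shows "\<one> \<notin> M"
  using assms left_ideal_eq_carrier_iff[of M] maximal_left_ideal.I_notcarr
    maximal_left_ideal.axioms(1) by blast

text \<open>The set is the kernel of the map from \<open>R\<close> to the simple module
  \<open>R/M\<close> sending \<open>a\<close> to the class of \<open>a \<otimes> r\<close>, a map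
  that is onto because \<open>r \<notin> M\<close>. The proof avoids quotients by working with
  \<open>M + K r\<close>. The result makes the radical closed under right multiplication.\<close>

lemma maximal_left_ideal_residual:
  assumes "maximal_left_ideal M R" and r: "r \<in> carrier R" "r \<notin> M"
  shows "maximal_left_ideal {a \<in> carrier R. a \<otimes> r \<in> M} R" (is "maximal_left_ideal ?N R")
proof -
  interpret M: maximal_left_ideal M R by fact
  have N: "left_ideal ?N R"
    using r by (intro left_idealI) (auto simp: l_distr m_assoc M.I_l_closed)
  have "K = ?N \<or> K = carrier R" if K: "left_ideal K R" "?N \<subseteq> K" for K
  proof (rule disjCI)
    assume "K \<noteq> carrier R"
    interpret K: left_ideal K R by fact
    let ?S = "{m \<oplus> a \<otimes> r | m a. m \<in> M \<and> a \<in> K}"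
    have Kc: "a \<in> carrier R" if "a \<in> K" for a using that K.a_subset by blast
    have Mc: "a \<in> carrier R" if "a \<in> M" for a using that M.a_subset by blast
    have S: "left_ideal ?S R"
      using left_ideal_sum_principal[OF M.left_ideal_axioms r(1) K(1)] .
    have MS: "m \<in> ?S" if "m \<in> M" for m
    proof -
      have "m = m \<oplus> \<zero> \<otimes> r" using that Mc r by simp
      then show ?thesis using that K.zero_closed by blast
    qed
    have "?S \<subseteq> carrier R" using r Kc Mc by auto
    with S MS have "?S = M \<or> ?S = carrier R" by (intro M.I_maximal) auto
    \<comment> \<open>Otherwise \<open>r = m \<oplus> a \<otimes> r\<close> with
      \<open>a \<in> K\<close>, so \<open>\<one> \<ominus> a\<close> lies in the residual, hence in
      \<open>K\<close>, and \<open>K\<close> contains \<open>\<one>\<close>.\<close>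
    moreover have "?S \<noteq> carrier R"
    proof
      assume "?S = carrier R"
      then obtain m a where ma: "r = m \<oplus> a \<otimes> r" "m \<in> M" "a \<in> K" using r by blast
      have ac: "a \<in> carrier R" and mc: "m \<in> carrier R" using ma(2,3) Kc Mc by auto
      have "(\<one> \<ominus> a) \<otimes> r = r \<ominus> a \<otimes> r"
        using r ac by (simp add: minus_eq l_distr l_minus)
      also have "\<dots> = (m \<oplus> a \<otimes> r) \<ominus> a \<otimes> r" by (simp only: ma(1)[symmetric])
      also have "\<dots> = m" using r ac mc by (simp add: minus_eq a_assoc r_neg)
      finally have "(\<one> \<ominus> a) \<otimes> r \<in> M" using ma(2) by simp
      then have "\<one> \<ominus> a \<in> K" using K(2) ac by auto
      then have "(\<one> \<ominus> a) \<oplus> a \<in> K" using ma(3) by (intro K.a_closed)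
      then have "\<one> \<in> K" using ac by (simp add: minus_eq a_assoc l_neg)
      then show False using \<open>K \<noteq> carrier R\<close> left_ideal_eq_carrier_iff[OF K(1)] by blast
    qed
    ultimately have "?S = M" by blast
    have "K \<subseteq> ?N"
    proof
      fix a assume a: "a \<in> K"
      have "a \<otimes> r = \<zero> \<oplus> a \<otimes> r" using a Kc r by simp
      then have "a \<otimes> r \<in> ?S" using a M.zero_closed by blast
      then show "a \<in> ?N" using \<open>?S = M\<close> a Kc by blast
    qed
    then show "K = ?N" using K(2) by blast
  qed
  moreover have "\<one> \<notin> ?N" using r by simp
  then have "carrier R \<noteq> ?N" using one_closed by metis
  ultimately show ?thesis
    using N by (intro maximal_left_ideal.intro maximal_left_ideal_axioms.intro) auto
qed

lemma mem_jacobson_radical_iff: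
  "x \<in> jacobson_radical R \<longleftrightarrow> x \<in> carrier R \<and> (\<forall>M. maximal_left_ideal M R \<longrightarrow> x \<in> M)"
  by (auto simp: jacobson_radical_def)

lemma ideal_jacobson_radical: "ideal (jacobson_radical R) R"
proof -
  have "left_ideal (jacobson_radical R) R"
  proof (rule left_idealI)
    have li: "left_ideal M R" if "maximal_left_ideal M R" for M
      using that by (rule maximal_left_ideal.axioms(1))
    note sg = left_ideal.axioms(1)[OF li]
    show "jacobson_radical R \<subseteq> carrier R" by (auto simp: jacobson_radical_def)
    show "\<zero> \<in> jacobson_radical R"
      by (auto simp: mem_jacobson_radical_iff additive_subgroup.zero_closed[OF sg])
    show "a \<oplus> b \<in> jacobson_radical R"
      if "a \<in> jacobson_radical R" "b \<in> jacobson_radical R" for a b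
      using that by (auto simp: mem_jacobson_radical_iff additive_subgroup.a_closed[OF sg])
    show "x \<otimes> a \<in> jacobson_radical R"
      if "a \<in> jacobson_radical R" "x \<in> carrier R" for a x
      using that by (auto simp: mem_jacobson_radical_iff left_ideal.I_l_closed[OF li])
  qed
  then interpret J: left_ideal "jacobson_radical R" R .
  show ?thesis
  proof (rule idealI[OF ring_axioms J.a_subgroup J.I_l_closed])
    fix a r assume a: "a \<in> jacobson_radical R" and r: "r \<in> carrier R"
    \<comment> \<open>If \<open>r \<notin> M\<close>, then \<open>a\<close> lies in the residual of
      \<open>M\<close> by \<open>r\<close>, itself a maximal left ideal.\<close>
    have "a \<otimes> r \<in> M" if M: "maximal_left_ideal M R" for M
    proof (cases "r \<in> M")
      case True
      then show ?thesis
        using a left_ideal.I_l_closed[OF maximal_left_ideal.axioms(1)[OF M]]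
        by (auto simp: mem_jacobson_radical_iff)
    next
      case False
      then show ?thesis
        using a maximal_left_ideal_residual[OF M r] by (auto simp: mem_jacobson_radical_iff)
    qed
    then show "a \<otimes> r \<in> jacobson_radical R"
      using a r by (auto simp: mem_jacobson_radical_iff)
  qed
qed

text \<open>If the left ideal generated by \<open>\<one> \<ominus> x\<close> were proper, a maximal
  left ideal would contain it and \<open>x\<close>, hence also \<open>\<one>\<close>.\<close>

lemma jacobson_radical_left_inverse:
  assumes x: "x \<in> jacobson_radical R"
  obtains y where "y \<in> carrier R" "y \<otimes> (\<one> \<ominus> x) = \<one>"
proof -
  have xc: "x \<in> carrier R" using x by (simp add: mem_jacobson_radical_iff)
  let ?I = "{m \<oplus> a \<otimes> (\<one> \<ominus> x) | m a. m \<in> {\<zero>} \<and> a \<in> carrier R}"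
  have I: "left_ideal ?I R"
    using xc by (intro left_ideal_sum_principal left_ideal_zero left_ideal_carrier) auto
  have "\<one> \<in> ?I"
  proof (rule ccontr)
    assume "\<one> \<notin> ?I"
    then obtain M where M: "maximal_left_ideal M R" "?I \<subseteq> M"
      using ex_maximal_left_ideal[OF I] by blast
    interpret M: maximal_left_ideal M R by fact
    have "\<one> \<ominus> x = \<zero> \<oplus> \<one> \<otimes> (\<one> \<ominus> x)" using xc by simp
    then have "\<one> \<ominus> x \<in> ?I" by blast
    then have "(\<one> \<ominus> x) \<oplus> x \<in> M"
      using M x by (intro M.a_closed) (auto simp: mem_jacobson_radical_iff)
    then have "\<one> \<in> M" using xc by (simp add: minus_eq a_assoc l_neg)
    then show False using maximal_left_ideal_one_notin[OF M(1)] by blast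
  qed
  then obtain a where a: "a \<in> carrier R" "\<one> = \<zero> \<oplus> a \<otimes> (\<one> \<ominus> x)" by blast
  have "\<zero> \<oplus> a \<otimes> (\<one> \<ominus> x) = a \<otimes> (\<one> \<ominus> x)" using a(1) xc by simp
  then show thesis using that[OF a(1)] a(2) by metis
qed

text \<open>\<open>\<one> \<ominus> e\<close> is left invertible and annihilates \<open>e\<close>
  from the left.\<close>

lemma idempotent_in_jacobson_radical:
  assumes e: "e \<in> jacobson_radical R" and idem: "e \<otimes> e = e"
  shows "e = \<zero>"
proof -
  have ec: "e \<in> carrier R" using e by (simp add: mem_jacobson_radical_iff)
  obtain y where y: "y \<in> carrier R" "y \<otimes> (\<one> \<ominus> e) = \<one>"
    using jacobson_radical_left_inverse[OF e] .
  have "e = (y \<otimes> (\<one> \<ominus> e)) \<otimes> e" using y ec by simp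
  also have "\<dots> = y \<otimes> ((\<one> \<ominus> e) \<otimes> e)" using y(1) ec by (intro m_assoc) auto
  also have "(\<one> \<ominus> e) \<otimes> e = \<zero>"
    using ec by (simp add: minus_eq l_distr l_minus idem r_neg)
  finally show ?thesis using y(1) by simp
qed

text \<open>If a maximal left ideal \<open>M\<close> misses \<open>q\<close>, then
  \<open>M + R q\<close> is everything, so \<open>\<one> = m \<oplus> z\<close> with
  \<open>z\<close> a left multiple of \<open>q\<close>. Such a \<open>z\<close> is nilpotent, which
  makes \<open>\<one> \<ominus> z\<close> a unit inside \<open>M\<close>.\<close>

lemma nil_left_ideal_subset_jacobson_radical:
  assumes I: "left_ideal I R" and nil: "I \<subseteq> Nil_set R"
  shows "I \<subseteq> jacobson_radical R"
proof
  fix q assume q: "q \<in> I"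
  interpret I: left_ideal I R by fact
  have qc: "q \<in> carrier R" using q I.a_subset by blast
  have "q \<in> M" if "maximal_left_ideal M R" for M
  proof (rule ccontr)
    assume "q \<notin> M"
    interpret M: maximal_left_ideal M R by fact
    have Mc: "a \<in> carrier R" if "a \<in> M" for a using that M.a_subset by blast
    let ?S = "{m \<oplus> a \<otimes> q | m a. m \<in> M \<and> a \<in> carrier R}"
    have "left_ideal ?S R"
      using left_ideal_sum_principal[OF M.left_ideal_axioms qc left_ideal_carrier] .
    moreover have "M \<subseteq> ?S"
    proof
      fix m assume "m \<in> M"
      moreover from this have "m = m \<oplus> \<zero> \<otimes> q" using Mc qc by simp
      ultimately show "m \<in> ?S" by blast
    qed
    moreover have "?S \<subseteq> carrier R" using qc Mc by auto
    moreover have "q \<in> ?S"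
    proof -
      have "q = \<zero> \<oplus> \<one> \<otimes> q" using qc by simp
      then show ?thesis using M.zero_closed by blast
    qed
    ultimately have "?S = carrier R" using M.I_maximal[of ?S] \<open>q \<notin> M\<close> by blast
    then obtain m a where ma: "\<one> = m \<oplus> a \<otimes> q" "m \<in> M" "a \<in> carrier R" by blast
    define z where "z = a \<otimes> q"
    have zc: "z \<in> carrier R" using ma qc by (simp add: z_def)
    have "z \<in> Nil_set R" using I.I_l_closed[OF q ma(3)] nil by (auto simp: z_def)
    then obtain n :: nat where n: "z [^] n = \<zero>" by (auto simp: mem_Nil_set_iff)
    have "\<one> \<ominus> z = m"
      using zc Mc[OF ma(2)] unfolding ma(1) z_def[symmetric] by (simp add: minus_eq a_assoc r_neg)
    then have z1: "\<one> \<ominus> z \<in> M" using ma(2) by simp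
    \<comment> \<open>Each \<open>\<one> \<ominus> z [^] k\<close> is a left multiple of
      \<open>\<one> \<ominus> z\<close>; the exponent that kills \<open>z\<close> then gives
      \<open>\<one>\<close>.\<close>
    have "\<one> \<ominus> z [^] k \<in> M" for k :: nat
    proof (induction k)
      case 0
      then show ?case by (simp add: minus_eq r_neg)
    next
      case (Suc k)
      have "\<one> \<ominus> z [^] Suc k = (\<one> \<ominus> z [^] k) \<oplus> z [^] k \<otimes> (\<one> \<ominus> z)"
        using zc by (simp add: minus_eq r_distr r_minus a_assoc) (simp add: l_neg flip: a_assoc)
      then show ?case using Suc z1 zc M.I_l_closed M.a_closed by simp
    qed
    from this[of n] have "\<one> \<in> M" by (simp add: n minus_eq)
    then show False using maximal_left_ideal_one_notin[OF that] by blast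
  qed
  then show "q \<in> jacobson_radical R" using qc by (simp add: mem_jacobson_radical_iff)
qed

subsection \<open>Periodic elements\<close>

text \<open>Congruence modulo \<open>I\<close> respects powers. The telescoping identity in the
  induction keeps the order of factors, so \<open>a\<close> and \<open>b\<close> may fail to
  commute.\<close>

lemma ideal_pow_diff:
  assumes "ideal I R" and ab: "a \<in> carrier R" "b \<in> carrier R" and d: "a \<ominus> b \<in> I"
  shows "a [^] (n :: nat) \<ominus> b [^] n \<in> I"
proof (induction n)
  interpret I: ideal I R by fact
  case 0
  show ?case by (simp add: minus_eq r_neg I.zero_closed)
next
  interpret I: ideal I R by fact
  case (Suc n)
  have "a [^] Suc n \<ominus> b [^] Suc n = a [^] n \<otimes> (a \<ominus> b) \<oplus> (a [^] n \<ominus> b [^] n) \<otimes> b"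
    using ab by (simp add: minus_eq l_distr r_distr l_minus r_minus a_assoc)
      (simp add: l_neg flip: a_assoc)
  then show ?case using Suc ab d I.I_l_closed I.I_r_closed I.a_closed by simp
qed

text \<open>From exponent \<open>m\<close> on, the powers of \<open>p\<close> repeat with period
  \<open>d\<close>. The exponent \<open>m * d\<close> is at least \<open>m\<close> and a multiple of
  \<open>d\<close>, so doubling it changes nothing.\<close>

lemma ex_idempotent_power:
  assumes "periodic_element R p"
  obtains k :: nat where "0 < k" "p [^] k \<otimes> p [^] k = p [^] k"
proof -
  have pc: "p \<in> carrier R" using assms by (simp add: periodic_element_def)
  obtain m n :: nat where mn: "0 < m" "m < n" "p [^] m = p [^] n"
    using assms unfolding periodic_element_def by (metis linorder_neqE_nat)
  define d where "d = n - m"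
  have d: "0 < d" "p [^] (m + d) = p [^] m" using mn by (auto simp: d_def)
  have step: "p [^] (i + d) = p [^] i" if "m \<le> i" for i
  proof -
    have "p [^] (i + d) = p [^] (i - m) \<otimes> p [^] (m + d)"
      using that pc by (simp add: nat_pow_mult)
    also have "\<dots> = p [^] i" using that pc by (simp only: d) (simp add: nat_pow_mult)
    finally show ?thesis .
  qed
  have "p [^] (m * d + j * d) = p [^] (m * d)" for j
  proof (induction j)
    case (Suc j)
    have "m \<le> m * d + j * d" using d(1) by (cases d) auto
    from step[OF this] show ?case using Suc by (simp add: algebra_simps)
  qed simp
  from this[of m] have "p [^] (m * d) \<otimes> p [^] (m * d) = p [^] (m * d)"
    using pc by (simp add: nat_pow_mult)
  then show thesis using that[of "m * d"] mn d by simp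
qed

section \<open>Integer multiples of one and sequences with vanishing higher differences\<close>

lemma add_minus_cancel:
  assumes "a \<in> carrier R" "b \<in> carrier R"
  shows "a \<oplus> (b \<ominus> a) = b"
  using assms by (simp add: minus_eq a_lcomm[of a b] r_neg)

lemma add_pow_one_pow: "([(c :: nat)] \<cdot> \<one>) [^] (k :: nat) = [(c ^ k)] \<cdot> \<one>"
proof (induction k)
  case (Suc k)
  have "([(c ^ k)] \<cdot> \<one>) \<otimes> ([c] \<cdot> \<one>) = [(c ^ k)] \<cdot> ([c] \<cdot> \<one>)"
    by (simp add: add_pow_ldistr)
  also have "\<dots> = [(c ^ Suc k)] \<cdot> \<one>" by (simp add: add.nat_pow_pow)
  finally show ?case using Suc by simp
qed simp

text \<open>The terms \<open>s \<otimes> y [^] j\<close> form a sequence with vanishing \<open>k\<close>-th differences. By induction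
  its first differences have a period \<open>t\<close>, so advancing by \<open>t\<close> adds a constant, and
  advancing by \<open>N * t\<close> adds \<open>N\<close> times that constant, which is zero.\<close>
lemma ex_period_of_unipotent:
  assumes N: "0 < N" "\<And>c. c \<in> carrier R \<Longrightarrow> [(N :: nat)] \<cdot> c = \<zero>"
    and y: "y \<in> carrier R"
  shows "\<lbrakk>s \<in> carrier R; s \<otimes> (y \<ominus> \<one>) [^] (k :: nat) = \<zero>\<rbrakk>
    \<Longrightarrow> \<exists>t > 0. \<forall>j :: nat. s \<otimes> y [^] (j + t) = s \<otimes> y [^] j"
proof (induction k arbitrary: s)
  case 0
  \<comment> \<open>Here the assumption reads \<open>s \<otimes> \<one> = \<zero>\<close>, so the
    sequence is zero.\<close>
  then show ?case using y by auto
next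
  case (Suc k)
  let ?a = "\<lambda>j :: nat. s \<otimes> y [^] j"
  let ?d = "\<lambda>j :: nat. (s \<otimes> (y \<ominus> \<one>)) \<otimes> y [^] j"
  have ac: "?a j \<in> carrier R" for j using Suc.prems y by simp
  have dc: "?d j \<in> carrier R" for j using Suc.prems y by simp
  \<comment> \<open>Passing to first differences moves one factor \<open>y \<ominus> \<one>\<close>
    into \<open>s\<close>, which lowers \<open>k\<close>.\<close>
  have "(s \<otimes> (y \<ominus> \<one>)) \<otimes> (y \<ominus> \<one>) [^] k = \<zero>"
    using Suc.prems y nat_pow_Suc2[of "y \<ominus> \<one>" k] by (simp add: m_assoc)
  then obtain t :: nat where t: "t > 0" "\<And>j. ?d (j + t) = ?d j"
    using Suc.IH[of "s \<otimes> (y \<ominus> \<one>)"] Suc.prems y by auto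
  have diff: "?a (Suc j) = ?a j \<oplus> ?d j" for j
  proof -
    have "?d j = s \<otimes> (y [^] Suc j \<ominus> y [^] j)"
      using Suc.prems y nat_pow_Suc2[of y j]
      by (simp add: m_assoc minus_eq l_distr l_minus del: nat_pow_Suc)
    also have "\<dots> = ?a (Suc j) \<ominus> ?a j"
      using Suc.prems y by (simp add: minus_eq r_distr r_minus)
    finally show ?thesis using add_minus_cancel ac by metis
  qed
  define c where "c = ?a t \<ominus> ?a 0"
  have cc: "c \<in> carrier R" using ac[of t] ac[of 0] by (simp add: c_def del: nat_pow_0)
  have shift: "?a (j + t) = ?a j \<oplus> c" for j
  proof (induction j)
    case 0
    then show ?case using add_minus_cancel[OF ac ac, of 0 t] by (simp add: c_def)
  next
    case (Suc j)
    have "?a (Suc j + t) = ?a (j + t) \<oplus> ?d (j + t)" using diff[of "j + t"] by simp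
    also have "\<dots> = (?a j \<oplus> ?d j) \<oplus> c"
      using ac[of j] dc[of j] cc unfolding Suc t(2) by (simp only: a_ac)
    finally show ?case by (simp only: diff)
  qed
  have "?a (j + i * t) = ?a j \<oplus> [i] \<cdot> c" for i j :: nat
  proof (induction i)
    case 0
    then show ?case using ac[of j] by simp
  next
    case (Suc i)
    have "?a (j + Suc i * t) = ?a (j + i * t) \<oplus> c"
      using shift[of "j + i * t"] by (simp add: algebra_simps)
    then show ?case using ac[of j] cc by (simp add: Suc a_assoc add.nat_pow_Suc)
  qed
  from this[of _ N] have "?a (j + N * t) = ?a j" for j
    using N(2)[OF cc] ac[of j] by simp
  then show ?case using N(1) t(1) by (intro exI[of _ "N * t"]) auto
qed

section \<open>Semi-nil clean rings\<close>

text \<open>Modulo the nilpotents \<open>x\<close> equals its periodic part \<open>p\<close>, so a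
  coincidence \<open>p [^] m = p [^] n\<close> passes to \<open>x\<close> up to a nilpotent
  error.\<close>

lemma nilpotent_diff_of_periodic_diff:
  assumes snc: "semi_nil_clean_ring R" and "ideal (Nil_set R) R" and x: "x \<in> carrier R"
  obtains m n k :: nat
  where "0 < m" "m < n" "(x [^] n \<ominus> x [^] m) [^] k = \<zero>"
proof -
  interpret N: ideal "Nil_set R" R by fact
  obtain p q where pq: "periodic_element R p" "nilpotent_element R q" "x = p \<oplus> q"
    using snc x unfolding semi_nil_clean_ring_def semi_nil_clean_element_def by blast
  have c: "p \<in> carrier R" "q \<in> carrier R"
    using pq by (auto simp: periodic_element_def nilpotent_element_def)
  obtain m n :: nat where mn: "0 < m" "m < n" "p [^] m = p [^] n"
    using pq(1) unfolding periodic_element_def by (metis linorder_neqE_nat)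
  have "x \<ominus> p = q" using c unfolding pq(3) by (simp add: minus_eq a_assoc a_lcomm[of p q] r_neg)
  then have "x \<ominus> p \<in> Nil_set R" using pq(2) by (simp add: Nil_set_def)
  then have d: "x [^] i \<ominus> p [^] i \<in> Nil_set R" for i :: nat
    using ideal_pow_diff[OF assms(2) x c(1)] by blast
  have "x [^] n \<ominus> x [^] m = (x [^] n \<ominus> p [^] n) \<oplus> \<ominus> (x [^] m \<ominus> p [^] m)"
    using x c by (simp add: mn(3) minus_eq minus_add a_ac r_neg2)
  also have "\<dots> \<in> Nil_set R" using d by (intro N.a_closed N.a_inv_closed)
  finally show thesis using that mn by (auto simp: mem_Nil_set_iff)
qed

lemma positive_characteristic:
  assumes "semi_nil_clean_ring R" "ideal (Nil_set R) R"
  obtains N :: nat where "0 < N" "\<And>c. c \<in> carrier R \<Longrightarrow> [N] \<cdot> c = \<zero>"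
proof -
  have two: "[(2 :: nat)] \<cdot> \<one> \<in> carrier R" by simp
  obtain m n k :: nat where
    mn: "0 < m" "m < n" and nil: "(([(2 :: nat)] \<cdot> \<one>) [^] n \<ominus> ([(2 :: nat)] \<cdot> \<one>) [^] m) [^] k = \<zero>"
    using nilpotent_diff_of_periodic_diff[OF assms two] .
  \<comment> \<open>The nilpotent difference of powers of two is the integer \<open>C\<close>,
    positive since \<open>m < n\<close>; so \<open>C ^ k\<close> annihilates the ring.\<close>
  define C :: nat where "C = 2 ^ n - 2 ^ m"
  have C: "0 < C" "2 ^ n = C + 2 ^ m" using mn by (auto simp: C_def)
  have "[((2 :: nat) ^ n)] \<cdot> \<one> = [C] \<cdot> \<one> \<oplus> [((2 :: nat) ^ m)] \<cdot> \<one>"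
    unfolding C(2) by (simp add: add.nat_pow_mult)
  then have "([(2 :: nat)] \<cdot> \<one>) [^] n \<ominus> ([(2 :: nat)] \<cdot> \<one>) [^] m = [C] \<cdot> \<one>"
    by (simp add: add_pow_one_pow minus_eq a_assoc r_neg)
  with nil have 0: "[(C ^ k)] \<cdot> \<one> = \<zero>" by (simp add: add_pow_one_pow)
  have "[(C ^ k)] \<cdot> c = \<zero>" if "c \<in> carrier R" for c
    using add_pow_ldistr[of \<one> c "C ^ k"] that 0 by simp
  then show thesis using that[of "C ^ k"] C by simp
qed

lemma semi_nil_clean_NI_imp_periodic:
  assumes "semi_nil_clean_ring R" "ideal (Nil_set R) R"
  shows "periodic_ring R"
  unfolding periodic_ring_def
proof
  fix x assume x: "x \<in> carrier R"
  obtain N :: nat where N: "0 < N" "\<And>c. c \<in> carrier R \<Longrightarrow> [N] \<cdot> c = \<zero>"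
    using positive_characteristic[OF assms] by blast
  obtain m n k :: nat where mn: "0 < m" "m < n" and nil: "(x [^] n \<ominus> x [^] m) [^] k = \<zero>"
    using nilpotent_diff_of_periodic_diff[OF assms x] .
  define y where "y = x [^] (n - m)"
  have y: "y \<in> carrier R" using x by (simp add: y_def)
  have "x [^] m \<otimes> y = x [^] n" "y \<otimes> x [^] m = x [^] n"
    using x mn by (auto simp: y_def nat_pow_mult)
  \<comment> \<open>\<open>x [^] m\<close> and \<open>y \<ominus> \<one>\<close> commute, so the
    \<open>k\<close>-th power of their product splits.\<close>
  then have l: "x [^] m \<otimes> (y \<ominus> \<one>) = x [^] n \<ominus> x [^] m"
    and r: "(y \<ominus> \<one>) \<otimes> x [^] m = x [^] n \<ominus> x [^] m"
    using x y by (simp_all add: minus_eq r_distr l_distr r_minus l_minus)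
  have "(x [^] m) [^] k \<otimes> (y \<ominus> \<one>) [^] k = \<zero>"
    using pow_mult_distrib[of "x [^] m" "y \<ominus> \<one>" k] l r nil x y by simp
  then obtain t :: nat where t: "t > 0" "(x [^] m) [^] k \<otimes> y [^] t = (x [^] m) [^] k"
    using ex_period_of_unipotent[OF N y, of "(x [^] m) [^] k" k] x by (force dest: spec[of _ 0])
  have "x [^] (m * k + (n - m) * t) = x [^] (m * k)"
    using t(2) x by (simp add: y_def nat_pow_pow nat_pow_mult)
  \<comment> \<open>One more factor \<open>x\<close> keeps both exponents positive even when
    \<open>k = 0\<close>.\<close>
  then have "x [^] (m * k + (n - m) * t) \<otimes> x = x [^] (m * k) \<otimes> x" by simp
  then have "x [^] Suc (m * k + (n - m) * t) = x [^] Suc (m * k)" by simp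
  then show "periodic_element R x"
    using x t(1) mn unfolding periodic_element_def
    by (intro conjI exI[of _ "Suc (m * k + (n - m) * t)"] exI[of _ "Suc (m * k)"]) auto
qed

lemma semi_nil_clean_jacobson_radical_nil:
  assumes snc: "semi_nil_clean_ring R" and "additive_subgroup (Nil_set R) R"
    and x: "x \<in> jacobson_radical R"
  shows "x \<in> Nil_set R"
proof -
  interpret N: additive_subgroup "Nil_set R" R by fact
  interpret J: ideal "jacobson_radical R" R by (rule ideal_jacobson_radical)
  have xc: "x \<in> carrier R" using x by (simp add: mem_jacobson_radical_iff)
  obtain p q where pq: "periodic_element R p" "nilpotent_element R q" "x = p \<oplus> q"
    using snc xc unfolding semi_nil_clean_ring_def semi_nil_clean_element_def by blast
  have c: "p \<in> carrier R" "q \<in> carrier R"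
    using pq by (auto simp: periodic_element_def nilpotent_element_def)
  have q: "q \<in> Nil_set R" using pq by (simp add: Nil_set_def)
  \<comment> \<open>Modulo the radical \<open>p\<close> is congruent to \<open>\<ominus> q\<close>,
    so the exponent killing \<open>\<ominus> q\<close> sends \<open>p\<close> into the
    radical.\<close>
  have "\<ominus> q \<in> Nil_set R" using q by (rule N.a_inv_closed)
  then obtain n :: nat where n: "0 < n" "(\<ominus> q) [^] n = \<zero>" by (auto simp: mem_Nil_set_iff)
  have "p \<ominus> \<ominus> q \<in> jacobson_radical R" using x c by (simp add: pq(3) minus_eq)
  then have "p [^] n \<ominus> (\<ominus> q) [^] n \<in> jacobson_radical R"
    using c by (intro ideal_pow_diff[OF ideal_jacobson_radical]) auto
  then have pn: "p [^] n \<in> jacobson_radical R" using c n by (simp add: minus_eq)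
  obtain k :: nat where k: "0 < k" "p [^] k \<otimes> p [^] k = p [^] k"
    using ex_idempotent_power[OF pq(1)] .
  have "(p [^] k) [^] Suc i = p [^] k" for i :: nat
    by (induction i) (use k c in auto)
  \<comment> \<open>Raising the idempotent \<open>p [^] k\<close> to the power \<open>n\<close>
    leaves it unchanged but exposes a factor \<open>p [^] n\<close> from the radical.\<close>
  from this[of "n - 1"] have "p [^] k = (p [^] k) [^] n" using n by simp
  also have "\<dots> = p [^] (n * (k - 1)) \<otimes> p [^] n"
  proof -
    have "k * n = n * (k - 1) + n" using k(1) by (cases k) simp_all
    then show ?thesis using c(1) by (simp only: nat_pow_pow nat_pow_mult)
  qed
  also have "\<dots> \<in> jacobson_radical R" using pn c by (intro J.I_l_closed) auto
  finally have "p [^] k = \<zero>" using k(2) by (rule idempotent_in_jacobson_radical)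
  then have "p \<in> Nil_set R" using c k(1) by (auto simp: mem_Nil_set_iff)
  then show ?thesis using q N.a_closed by (simp add: pq(3))
qed

lemma periodic_imp_semi_nil_clean:
  assumes "periodic_ring R"
  shows "semi_nil_clean_ring R"
  unfolding semi_nil_clean_ring_def semi_nil_clean_element_def
proof
  fix x assume x: "x \<in> carrier R"
  have "nilpotent_element R \<zero>"
    unfolding nilpotent_element_def by (auto intro: exI[of _ 1])
  moreover have "periodic_element R x" using assms x by (simp add: periodic_ring_def)
  moreover have "x = x \<oplus> \<zero>" using x by simp
  ultimately show "\<exists>p q. periodic_element R p \<and> nilpotent_element R q \<and> x = p \<oplus> q" by blast
qed

end

theorem theorem2p5:
  fixes R (structure)
  assumes "ring R"
  shows "(semi_nil_clean_ring R \<and> additive_subgroup (Nil_set R) R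
            \<longrightarrow> (\<forall>x \<in> jacobson_radical R. nilpotent_element R x))
       \<and> ((semi_nil_clean_ring R \<and> NI_ring R)
            \<longleftrightarrow> (jacobson_radical R = Nil_set R \<and> periodic_ring R))"
proof -
  interpret ring R by fact
  have nil: "jacobson_radical R \<subseteq> Nil_set R"
    if "semi_nil_clean_ring R" "additive_subgroup (Nil_set R) R"
    using semi_nil_clean_jacobson_radical_nil[OF that] by blast
  have "jacobson_radical R = Nil_set R \<and> periodic_ring R"
    if snc: "semi_nil_clean_ring R" and NI: "ideal (Nil_set R) R"
  proof
    interpret N: ideal "Nil_set R" R by fact
    \<comment> \<open>One inclusion is the first claim; the other holds because
      \<open>Nil_set R\<close> is a nil left ideal.\<close>
    have "left_ideal (Nil_set R) R"
      using N.zero_closed N.a_closed N.I_l_closed N.a_subset by (intro left_idealI)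
    then show "jacobson_radical R = Nil_set R"
      using nil[OF snc N.additive_subgroup_axioms] nil_left_ideal_subset_jacobson_radical by blast
    show "periodic_ring R" using snc NI by (rule semi_nil_clean_NI_imp_periodic)
  qed
  \<comment> \<open>Here \<open>Nil_set R\<close> is an ideal because it equals the radical, and
    each periodic \<open>x\<close> decomposes as \<open>x \<oplus> \<zero>\<close>.\<close>
  moreover have "semi_nil_clean_ring R \<and> ideal (Nil_set R) R"
    if "jacobson_radical R = Nil_set R" "periodic_ring R"
    using that periodic_imp_semi_nil_clean ideal_jacobson_radical by simp
  moreover have "\<forall>x \<in> jacobson_radical R. nilpotent_element R x"
    if "semi_nil_clean_ring R" "additive_subgroup (Nil_set R) R"
    using nil[OF that] by (auto simp: Nil_set_def)
  ultimately show ?thesis unfolding NI_ring_def by blast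
qed

end
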